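(* Let $G$ be a graph and let $\mathcal{H}=\{H_x \mid x\in V(G)\}$ be a family of graphs indexed by the vertices of $G$. Let $G[\mathcal{H}]$ be the lexicographic product of $G$ and $\mathcal{H}$. Then: 1. If $H_x$ is complete for every $x\in V(G)$, then $G[\mathcal{H}]$ is vertex decomposable if and only if $G$ is vertex decomposable. 2. If $G$ is totally disconnected, then $H_x$ is vertex decomposable for every $x\in V(G)$ if and only if $G[\mathcal{H}]$ is vertex decomposable. 3. If $G$ is not totally disconnected and $G[\mathcal{H}]$ is vertex decomposable, then $H_x$ is complete for some $x\in V(G)$. 4. If $G[\mathcal{H}]$ is vertex decomposable, then $G$ is vertex decomposable and $H_x$ is vertex decomposable for all $x\in V(G)$.
   Context: All graphs are non-empty (at least one vertex), finite and simple, except that the empty graph (no vertices) may arise on deleting vertices and then counts as totally disconnected. A graph is totally disconnected if it has no edges. The lexicographic product $G[\mathcal{H}]$ is the graph with vertex set $\bigcup_{x\in V(G)}\{(x,y)\mid y\in V(H_x)\}$ in which $(x,y)$ and $(x',y')$ are adjacent if either $x=x'$ and $y$ is adjacent to $y'$ in $H_x$, or $x$ is adjacent to $x'$ in $G$. For a vertex $x$ of $G$, $N_G(x)$ is the set of vertices adjacent to $x$ and $N_G[x]=N_G(x)\cup\{x\}$; $G\setminus S$ is the induced subgraph on $V(G)\setminus S$ and $G\setminus x=G\setminus\{x\}$. A vertex $x$ is a shedding vertex of $G$ if no independent set of vertices in $G\setminus N_G[x]$ is a maximal independent set of vertices in $G\setminus x$. A graph $G$ is vertex decomposable if (recursively)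 either it is totally disconnected or it has a shedding vertex $x$ such that $G\setminus x$ and $G\setminus N_G[x]$ are both vertex decomposable. *)

theory Defs
  imports "Graph_Theory.Graph_Theory"
begin

text \<open>
  Finite simple graphs are taken from \<^theory>\<open>Graph_Theory.Digraph\<close>: the locale \<^locale>\<open>graph\<close>
  describes finite, loop-free, symmetric digraphs without parallel arcs, so an edge is a pair of
  opposite arcs. That locale allows the graph without vertices.
\<close>

definition totally_disconnected :: "('a, 'b) pre_digraph \<Rightarrow> bool" where
  "totally_disconnected G \<longleftrightarrow> arcs G = {}"

text \<open>
  The library's predicate for complete graphs carries the number of vertices as a parameter;
  the graph with exactly one vertex is complete.
\<close>

definition complete_graph :: "('a, 'b) pre_digraph \<Rightarrow> bool" where
  "complete_graph G \<longleftrightarrow> K\<^bsub>card (verts G)\<^esub> G"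

definition neighborhood :: "('a, 'b) pre_digraph \<Rightarrow> 'a \<Rightarrow> 'a set" where
  "neighborhood G x = {y \<in> verts G. x \<rightarrow>\<^bsub>G\<^esub> y}"

definition closed_neighborhood :: "('a, 'b) pre_digraph \<Rightarrow> 'a \<Rightarrow> 'a set" where
  "closed_neighborhood G x = neighborhood G x \<union> {x}"

definition delete_verts :: "('a, 'b) pre_digraph \<Rightarrow> 'a set \<Rightarrow> ('a, 'b) pre_digraph" where
  "delete_verts G S = G \<restriction> (verts G - S)"

definition independent_set :: "('a, 'b) pre_digraph \<Rightarrow> 'a set \<Rightarrow> bool" where
  "independent_set G S \<longleftrightarrow> S \<subseteq> verts G \<and> (\<forall>u\<in>S. \<forall>v\<in>S. \<not> u \<rightarrow>\<^bsub>G\<^esub> v)"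

definition maximal_independent_set :: "('a, 'b) pre_digraph \<Rightarrow> 'a set \<Rightarrow> bool" where
  "maximal_independent_set G S \<longleftrightarrow>
    independent_set G S \<and> (\<forall>T. independent_set G T \<and> S \<subseteq> T \<longrightarrow> T = S)"

definition shedding_vertex :: "('a, 'b) pre_digraph \<Rightarrow> 'a \<Rightarrow> bool" where
  "shedding_vertex G x \<longleftrightarrow> x \<in> verts G \<and>
    \<not> (\<exists>S. independent_set (delete_verts G (closed_neighborhood G x)) S \<and>
           maximal_independent_set (delete_verts G {x}) S)"

inductive vertex_decomposable :: "('a, 'b) pre_digraph \<Rightarrow> bool" where
  totally_disconnected: "totally_disconnected G \<Longrightarrow> vertex_decomposable G"
| shedding: "shedding_vertex G x \<Longrightarrow> vertex_decomposable (delete_verts G {x}) \<Longrightarrow>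
    vertex_decomposable (delete_verts G (closed_neighborhood G x)) \<Longrightarrow> vertex_decomposable G"

definition lexicographic_product ::
  "('a, 'b) pre_digraph \<Rightarrow> ('a \<Rightarrow> ('c, 'd) pre_digraph) \<Rightarrow> ('a \<times> 'c, ('a \<times> 'c) \<times> ('a \<times> 'c)) pre_digraph"
where
  "lexicographic_product G H = (let V = (SIGMA x:verts G. verts (H x)) in
    with_proj \<lparr> pverts = V,
      parcs = {((x, y), (x', y')). (x, y) \<in> V \<and> (x', y') \<in> V \<and>
                (x = x' \<and> y \<rightarrow>\<^bsub>H x\<^esub> y' \<or> x \<rightarrow>\<^bsub>G\<^esub> x')} \<rparr>)"

lemma graph_delete_verts:
  assumes "graph G"
  shows "graph (delete_verts G S)"
proof -
  interpret graph G by (fact assms)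
  have "induced_subgraph (delete_verts G S) G"
    unfolding delete_verts_def by (rule induced_induce) blast
  then show ?thesis
    using sym_arcs by (blast intro: digraph.graphI digraphI_induced induced_graph_imp_symmetric)
qed

lemma graph_lexicographic_product:
  assumes G: "graph G" and H: "\<And>x. x \<in> verts G \<Longrightarrow> graph (H x)"
  shows "graph (lexicographic_product G H)"
proof -
  interpret G: graph G by (fact G)
  define V where "V = (SIGMA x:verts G. verts (H x))"
  define A where "A = {((x, y), (x', y')). (x, y) \<in> V \<and> (x', y') \<in> V \<and>
    (x = x' \<and> y \<rightarrow>\<^bsub>H x\<^esub> y' \<or> x \<rightarrow>\<^bsub>G\<^esub> x')}"
  have fin: "finite V"
    unfolding V_def using H
    by (meson G.finite_verts digraph.axioms(1) fin_digraph.finite_verts finite_SigmaI graph.axioms(1))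
  have AV: "A \<subseteq> V \<times> V" by (auto simp: A_def)
  have symH: "y' \<rightarrow>\<^bsub>H x\<^esub> y" if "x \<in> verts G" "y \<rightarrow>\<^bsub>H x\<^esub> y'" for x y y'
  proof -
    interpret Hx: graph "H x" using H that(1) .
    show ?thesis using Hx.sym_arcs that(2) by (auto simp: symmetric_def elim: symE)
  qed
  have irrH: "\<not> y \<rightarrow>\<^bsub>H x\<^esub> y" if "x \<in> verts G" for x y
  proof -
    interpret Hx: graph "H x" using H that .
    show ?thesis by (auto dest: Hx.adj_not_same)
  qed
  have "sym A"
    using symH G.sym_arcs by (auto simp: sym_def A_def V_def symmetric_def)
  then have "pair_graph \<lparr> pverts = V, parcs = A \<rparr>"
    using fin AV finite_subset[OF AV] irrH
    by unfold_locales (auto simp: A_def V_def symmetric_def dest: G.adj_not_same)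
  then show ?thesis
    by (auto simp: lexicographic_product_def Let_def V_def A_def dest: pair_graph.pair_graphD_graph)
qed

end

theory Submission
  imports Defs
begin

text \<open>
  Deleting vertices from a lexicographic product leaves a lexicographic product: a set \<open>W\<close> of
  pairs induces the product over the base \<open>Domain W\<close> whose factor at \<open>x\<close> is the fibre
  \<open>W `` {x}\<close>. So the whole argument runs over arbitrary relations \<open>W\<close>, and an induction
  along a vertex decomposition never leaves this class. For this reason graphs are replaced by a
  fixed adjacency relation together with a varying vertex set. A vertex \<open>x\<close> of \<open>V\<close> then sheds
  exactly if every independent set that avoids the closed neighbourhood of \<open>x\<close> can be extended by
  a neighbour of \<open>x\<close>.

  The four assertions follow from one necessary and one sufficient condition.

  Necessity (\<open>decomposable_lex_adjD\<close>): if the product is decomposable, so are the base and all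
  fibres, and if the base has an edge, some fibre is a clique. Let \<open>(x, y)\<close> be a shedding vertex
  of the product. A nonempty independent set inside the fibre of \<open>x\<close> is adjacent to everything in
  the neighbouring fibres, so the vertex that extends it can only lie in the fibre of \<open>x\<close> itself.
  Hence \<open>y\<close> sheds in its fibre unless that fibre is \<open>{y}\<close>. If it is \<open>{y}\<close>, the extending vertex
  always lies in a neighbouring fibre, and \<open>x\<close> sheds in the base. The clique is found by
  the same observation: if the deletion of \<open>(x, y)\<close> turned the fibre of \<open>x\<close> into a clique and \<open>y\<close>
  were not adjacent to some \<open>a\<close> in it, the singleton \<open>{a}\<close> could not be extended.

  Sufficiency (\<open>decomposable_lex_adjI\<close>): the product is decomposable if the base and the fibres
  are and every non-isolated vertex of the base carries a clique. As long as some fibre has an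
  edge, a shedding vertex of that fibre sheds in the product. After that all fibres are
  edgeless, those over non-isolated vertices are single points, and shedding vertices of the base
  lift. The induced subgraphs that arise inherit the hypotheses because decomposability passes to
  links (\<open>decomposable_link\<close>).
\<close>

section \<open>Vertex decomposability for an adjacency relation\<close>

text \<open>
  The vertex set is a bare argument, so the same predicate serves for independent sets of vertices
  and for vertex sets that induce a totally disconnected graph.
\<close>

definition edgeless :: "('a \<Rightarrow> 'a \<Rightarrow> bool) \<Rightarrow> 'a set \<Rightarrow> bool" where
  "edgeless E S \<longleftrightarrow> (\<forall>u\<in>S. \<forall>v\<in>S. \<not> E u v)"

definition clique :: "('a \<Rightarrow> 'a \<Rightarrow> bool) \<Rightarrow> 'a set \<Rightarrow> bool" where
  "clique E S \<longleftrightarrow> (\<forall>u\<in>S. \<forall>v\<in>S. u \<noteq> v \<longrightarrow> E u v)"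

definition closed_nbrs :: "('a \<Rightarrow> 'a \<Rightarrow> bool) \<Rightarrow> 'a \<Rightarrow> 'a set" where
  "closed_nbrs E x = insert x {y. E x y}"

definition sheds :: "('a \<Rightarrow> 'a \<Rightarrow> bool) \<Rightarrow> 'a set \<Rightarrow> 'a \<Rightarrow> bool" where
  "sheds E V x \<longleftrightarrow> x \<in> V \<and>
    (\<forall>S \<subseteq> V - closed_nbrs E x. edgeless E S \<longrightarrow> (\<exists>y\<in>V. E x y \<and> (\<forall>s\<in>S. \<not> E y s)))"

inductive decomposable :: "('a \<Rightarrow> 'a \<Rightarrow> bool) \<Rightarrow> 'a set \<Rightarrow> bool" for E where
  edgeless: "edgeless E V \<Longrightarrow> decomposable E V"
| sheds: "sheds E V x \<Longrightarrow> decomposable E (V - {x}) \<Longrightarrow>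
    decomposable E (V - closed_nbrs E x) \<Longrightarrow> decomposable E V"

locale adjacency =
  fixes E :: "'a \<Rightarrow> 'a \<Rightarrow> bool"
  assumes sym: "E u v \<Longrightarrow> E v u" and irrefl: "\<not> E u u"

lemma shedsI:
  assumes "x \<in> V"
    and "\<And>S. S \<subseteq> V - closed_nbrs E x \<Longrightarrow> edgeless E S \<Longrightarrow> \<exists>y\<in>V. E x y \<and> (\<forall>s\<in>S. \<not> E y s)"
  shows "sheds E V x"
  using assms by (auto simp: sheds_def)

lemma shedsE:
  assumes "sheds E V x" "S \<subseteq> V - closed_nbrs E x" "edgeless E S"
  obtains y where "y \<in> V" "E x y" "\<And>s. s \<in> S \<Longrightarrow> \<not> E y s"
  using assms that unfolding sheds_def by meson

lemma sheds_mem: "sheds E V x \<Longrightarrow> x \<in> V"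
  by (simp add: sheds_def)

lemma sheds_has_neighbour: "sheds E V x \<Longrightarrow> \<exists>y\<in>V. E x y"
  by (rule shedsE[of E V x "{}"]) (auto simp: edgeless_def)

lemma edgeless_subset: "edgeless E V \<Longrightarrow> U \<subseteq> V \<Longrightarrow> edgeless E U"
  by (auto simp: edgeless_def)

lemma decomposable_empty: "decomposable E {}"
  by (rule decomposable.edgeless) (simp add: edgeless_def)

context adjacency
begin

text \<open>
  A shedding vertex \<open>x\<close> not adjacent to \<open>y\<close> still sheds in the link of \<open>y\<close>: to extend an
  independent set \<open>S\<close> of the link, extend \<open>insert y S\<close> instead, which forces the new vertex to avoid the
  neighbours of \<open>y\<close>. A shedding vertex adjacent to \<open>y\<close> is absent from the link.
\<close>

lemma decomposable_link:
  "decomposable E V \<Longrightarrow> y \<in> V \<Longrightarrow> decomposable E (V - closed_nbrs E y)"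
proof (induction rule: decomposable.induct)
  case (edgeless V)
  then show ?case by (meson Diff_subset decomposable.edgeless edgeless_subset)
next
  case (sheds V x)
  consider "y = x" | "E x y" | "y \<noteq> x" "\<not> E x y" by blast
  then show ?case
  proof cases
    case 1
    then show ?thesis using sheds by simp
  next
    case 2
    then have "V - closed_nbrs E y = (V - {x}) - closed_nbrs E y"
      using sym by (auto simp: closed_nbrs_def)
    then show ?thesis using 2 sheds irrefl by auto
  next
    case 3
    let ?W = "V - closed_nbrs E y"
    have xy: "\<not> E y x" using 3 sym by blast
    have "sheds E ?W x"
    proof (rule shedsI)
      show "x \<in> ?W" using 3 xy sheds_mem[OF sheds.hyps(1)] by (auto simp: closed_nbrs_def)
      fix S assume S: "S \<subseteq> ?W - closed_nbrs E x" "edgeless E S"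
      have "insert y S \<subseteq> V - closed_nbrs E x" "edgeless E (insert y S)"
        using S 3 sheds.prems irrefl sym by (auto simp: closed_nbrs_def edgeless_def)
      from shedsE[OF sheds.hyps(1) this] obtain z
        where "z \<in> V" "E x z" "\<And>s. s \<in> insert y S \<Longrightarrow> \<not> E z s" by metis
      then show "\<exists>z\<in>?W. E x z \<and> (\<forall>s\<in>S. \<not> E z s)"
        using 3 sym by (intro bexI[of _ z]) (auto simp: closed_nbrs_def)
    qed
    moreover have "?W - {x} = (V - {x}) - closed_nbrs E y"
      "?W - closed_nbrs E x = (V - closed_nbrs E x) - closed_nbrs E y" by auto
    ultimately show ?thesis
      using sheds 3 by (intro decomposable.sheds[of E ?W x]) (auto simp: closed_nbrs_def)
  qed
qed

lemma decomposable_clique: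
  assumes "finite V" "clique E V"
  shows "decomposable E V"
  using assms
proof (induction V)
  case empty
  show ?case by (rule decomposable_empty)
next
  case (insert x V)
  show ?case
  proof (cases "V = {}")
    case True
    then show ?thesis using irrefl by (auto intro!: decomposable.edgeless simp: edgeless_def)
  next
    case False
    have all: "insert x V - closed_nbrs E x = {}"
      using insert.prems by (auto simp: clique_def closed_nbrs_def)
    have "sheds E (insert x V) x"
    proof (rule shedsI)
      obtain y where "y \<in> V" using False by blast
      then have "E x y" using insert.prems insert.hyps by (auto simp: clique_def)
      with \<open>y \<in> V\<close> show "\<exists>y\<in>insert x V. E x y \<and> (\<forall>s\<in>S. \<not> E y s)"
        if "S \<subseteq> insert x V - closed_nbrs E x" for S
        using that all by auto
    qed simp
    moreover have "decomposable E (insert x V - {x})"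
      using insert by (auto simp: clique_def)
    moreover have "decomposable E (insert x V - closed_nbrs E x)"
      unfolding all by (rule decomposable_empty)
    ultimately show ?thesis by (rule decomposable.sheds)
  qed
qed

end

section \<open>Induced subgraphs of lexicographic products\<close>

definition lex_adj :: "('a \<Rightarrow> 'a \<Rightarrow> bool) \<Rightarrow> ('a \<Rightarrow> 'c \<Rightarrow> 'c \<Rightarrow> bool) \<Rightarrow> 'a \<times> 'c \<Rightarrow> 'a \<times> 'c \<Rightarrow> bool" where
  "lex_adj E F = (\<lambda>(x, y) (x', y'). x = x' \<and> F x y y' \<or> E x x')"

lemma lex_adj_simp [simp]: "lex_adj E F (x, y) (x', y') \<longleftrightarrow> x = x' \<and> F x y y' \<or> E x x'"
  by (simp add: lex_adj_def)

locale lex_product = adjacency E for E :: "'a \<Rightarrow> 'a \<Rightarrow> bool" +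
  fixes F :: "'a \<Rightarrow> 'c \<Rightarrow> 'c \<Rightarrow> bool"
  assumes fibre: "adjacency (F x)"
begin

lemma fibre_sym: "F x y z \<Longrightarrow> F x z y"
  using fibre[of x] by (auto simp: adjacency_def)

lemma fibre_irrefl: "\<not> F x y y"
  using fibre[of x] by (auto simp: adjacency_def)

lemma fibre_remove:
  "(W - {(x, y)}) `` {z} = (if z = x then W `` {x} - {y} else W `` {z})"
  by auto

lemma fibre_link:
  "(W - closed_nbrs (lex_adj E F) (x, y)) `` {z} =
    (if z = x then W `` {x} - closed_nbrs (F x) y else if E x z then {} else W `` {z})"
  using irrefl by (auto simp: closed_nbrs_def)

lemma Domain_link:
  "z \<in> Domain (W - closed_nbrs (lex_adj E F) (x, y)) \<longleftrightarrow>
    (if z = x then \<not> W `` {x} \<subseteq> closed_nbrs (F x) y else \<not> E x z \<and> z \<in> Domain W)"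
proof -
  have "z \<in> Domain R \<longleftrightarrow> R `` {z} \<noteq> {}" for R :: "('a \<times> 'c) set" by blast
  then show ?thesis by (simp add: fibre_link)
qed

lemma edgeless_lex_adj:
  "edgeless (lex_adj E F) W \<longleftrightarrow> edgeless E (Domain W) \<and> (\<forall>x. edgeless (F x) (W `` {x}))"
proof
  assume W: "edgeless (lex_adj E F) W"
  have "\<not> E x x'" if "(x, y) \<in> W" "(x', y') \<in> W" for x y x' y'
    using W that unfolding edgeless_def by fastforce
  moreover have "\<not> F x y y'" if "(x, y) \<in> W" "(x, y') \<in> W" for x y y'
    using W that unfolding edgeless_def by fastforce
  ultimately show "edgeless E (Domain W) \<and> (\<forall>x. edgeless (F x) (W `` {x}))"
    by (auto simp: edgeless_def)
next
  assume "edgeless E (Domain W) \<and> (\<forall>x. edgeless (F x) (W `` {x}))"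
  then show "edgeless (lex_adj E F) W"
    unfolding edgeless_def by fastforce
qed

section \<open>Necessity\<close>

text \<open>
  The last claim about cliques is part of the induction because deleting a single vertex of a fibre
  with several vertices keeps the base and its edges, so a clique of the smaller product is at hand.
\<close>

lemma decomposable_lex_adjD:
  assumes "decomposable (lex_adj E F) W"
  shows "decomposable E (Domain W) \<and> (\<forall>x. decomposable (F x) (W `` {x})) \<and>
    (\<not> edgeless E (Domain W) \<longrightarrow> (\<exists>x\<in>Domain W. clique (F x) (W `` {x})))"
  using assms
proof (induction rule: decomposable.induct)
  case (edgeless W)
  then show ?case by (auto simp: edgeless_lex_adj intro: decomposable.edgeless)
next
  case (sheds W p)
  obtain x y where p: "p = (x, y)" by fastforce
  let ?A = "W `` {x}" and ?W1 = "W - {(x, y)}" and ?W2 = "W - closed_nbrs (lex_adj E F) (x, y)"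
  note sheds' = sheds.hyps(1)[unfolded p]
  have IH1: "decomposable E (Domain ?W1)" "\<And>z. decomposable (F z) (?W1 `` {z})"
    "\<not> edgeless E (Domain ?W1) \<Longrightarrow> \<exists>z\<in>Domain ?W1. clique (F z) (?W1 `` {z})"
    and IH2: "decomposable E (Domain ?W2)" "\<And>z. decomposable (F z) (?W2 `` {z})"
    using sheds.IH p by auto
  have xy: "(x, y) \<in> W" using sheds_mem[OF sheds'] .
  \<comment> \<open>A vertex over a neighbour of \<open>x\<close> is adjacent to all of \<open>{x} \<times> S\<close>, so for nonempty \<open>S\<close> the
    vertex extending \<open>{x} \<times> S\<close> lies over \<open>x\<close>.\<close>
  have neighbour_in_fibre: "\<exists>z\<in>?A. F x y z \<and> (\<forall>s\<in>S. \<not> F x z s)"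
    if S: "S \<subseteq> ?A - closed_nbrs (F x) y" "edgeless (F x) S" "S \<noteq> {}" for S
  proof -
    have "{x} \<times> S \<subseteq> W - closed_nbrs (lex_adj E F) (x, y)" "edgeless (lex_adj E F) ({x} \<times> S)"
      using S irrefl by (auto simp: closed_nbrs_def edgeless_def)
    from shedsE[OF sheds' this] obtain q
      where q: "q \<in> W" "lex_adj E F (x, y) q" "\<And>s. s \<in> {x} \<times> S \<Longrightarrow> \<not> lex_adj E F q s" by metis
    obtain x' z where "q = (x', z)" by fastforce
    with q S(3) sym show ?thesis by auto
  qed
  have fibres: "decomposable (F z) (W `` {z})" for z
  proof (cases "z = x")
    case False
    then show ?thesis using IH1(2)[of z] by (simp add: fibre_remove)
  next
    case [simp]: True
    show ?thesis
    proof (cases "?A = {y}")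
      case True
      then show ?thesis using fibre_irrefl by (auto intro!: decomposable.edgeless simp: edgeless_def)
    next
      case False
      have "sheds (F x) ?A y"
      proof (rule shedsI)
        show "y \<in> ?A" using xy by simp
        fix S assume S: "S \<subseteq> ?A - closed_nbrs (F x) y" "edgeless (F x) S"
        show "\<exists>z\<in>?A. F x y z \<and> (\<forall>s\<in>S. \<not> F x z s)"
        proof (cases "S = {}")
          case False
          then show ?thesis using neighbour_in_fibre S by blast
        next
          case [simp]: True
          \<comment> \<open>Here the shedding property of \<open>(x, y)\<close> may only give a neighbour over another base
            point, so the neighbour of \<open>y\<close> within the fibre comes from a second vertex \<open>a\<close>:
            either \<open>a\<close> itself, or the vertex extending \<open>{a}\<close>.\<close>
          obtain a where a: "a \<in> ?A" "a \<noteq> y" using False xy by blast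
          show ?thesis
          proof (cases "F x y a")
            case True
            then show ?thesis using a by auto
          next
            case False
            then have "{a} \<subseteq> ?A - closed_nbrs (F x) y" "edgeless (F x) {a}"
              using a fibre_irrefl by (auto simp: closed_nbrs_def edgeless_def)
            then show ?thesis using neighbour_in_fibre[of "{a}"] by auto
          qed
        qed
      qed
      then show ?thesis
        using IH1(2)[of x] IH2(2)[of x]
        by (auto simp: fibre_remove fibre_link intro: decomposable.sheds)
    qed
  qed
  have base: "decomposable E (Domain W)"
  proof (cases "?A = {y}")
    case False
    then have "Domain ?W1 = Domain W" using xy by auto
    then show ?thesis using IH1 by simp
  next
    case True
    then have dom: "Domain ?W1 = Domain W - {x}" "Domain ?W2 = Domain W - closed_nbrs E x"
      using irrefl fibre_irrefl by (auto simp: closed_nbrs_def)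
    have "sheds E (Domain W) x"
    proof (rule shedsI)
      show "x \<in> Domain W" using xy by blast
      fix S assume S: "S \<subseteq> Domain W - closed_nbrs E x" "edgeless E S"
      then have "\<forall>s\<in>S. \<exists>t. (s, t) \<in> W" by blast
      then obtain t where t: "\<And>s. s \<in> S \<Longrightarrow> (s, t s) \<in> W" by metis
      \<comment> \<open>One representative per fibre suffices: adjacency over distinct base points depends only on
        the base.\<close>
      have "(\<lambda>s. (s, t s)) ` S \<subseteq> W - closed_nbrs (lex_adj E F) (x, y)"
        "edgeless (lex_adj E F) ((\<lambda>s. (s, t s)) ` S)"
        using S t fibre_irrefl by (auto simp: closed_nbrs_def edgeless_def)
      from shedsE[OF sheds' this] obtain q
        where q: "q \<in> W" "lex_adj E F (x, y) q"
          "\<And>r. r \<in> (\<lambda>s. (s, t s)) ` S \<Longrightarrow> \<not> lex_adj E F q r" by metis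
      obtain x' z where q': "q = (x', z)" by fastforce
      have "z = y" if "x' = x" using q(1) q' True that by auto
      then have "x' \<noteq> x" using q(2) q' fibre_irrefl irrefl by auto
      then show "\<exists>z\<in>Domain W. E x z \<and> (\<forall>s\<in>S. \<not> E z s)"
        using q(1,2) q(3)[OF imageI] q' by (intro bexI[of _ x']) auto
    qed
    then show ?thesis using IH1(1) IH2(1) unfolding dom by (rule decomposable.sheds)
  qed
  have "\<exists>z\<in>Domain W. clique (F z) (W `` {z})" if edge: "\<not> edgeless E (Domain W)"
  proof (cases "?A = {y}")
    case True
    then show ?thesis using xy by (intro bexI[of _ x]) (auto simp: clique_def)
  next
    case False
    then have "Domain ?W1 = Domain W" using xy by auto
    then obtain z where z: "z \<in> Domain W" "clique (F z) (?W1 `` {z})" using IH1(3) edge by auto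
    show ?thesis
    proof (cases "z = x")
      case False
      then show ?thesis using z by (auto simp: fibre_remove)
    next
      case True
      then have K: "clique (F x) (?A - {y})" using z by (simp add: fibre_remove)
      have "F x y a" if a: "a \<in> ?A" "a \<noteq> y" for a
      proof (rule ccontr)
        assume "\<not> F x y a"
        then have "{a} \<subseteq> ?A - closed_nbrs (F x) y" "edgeless (F x) {a}"
          using a fibre_irrefl by (auto simp: closed_nbrs_def edgeless_def)
        from neighbour_in_fibre[OF this] obtain b where b: "b \<in> ?A" "F x y b" "\<not> F x b a" by auto
        then have "b \<noteq> a" "b \<noteq> y" using \<open>\<not> F x y a\<close> fibre_irrefl by auto
        then show False using K a b by (auto simp: clique_def)
      qed
      then have "clique (F x) ?A" using K fibre_sym unfolding clique_def by blast
      then show ?thesis using xy by blast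
    qed
  qed
  then show ?case using base fibres by blast
qed

section \<open>Sufficiency\<close>

text \<open>
  Asking for cliques only over non-isolated base points lets one statement cover both complete factors over any base and arbitrary decomposable factors over an edgeless base.
\<close>

lemma decomposable_lex_adjI:
  assumes "finite W" "decomposable E (Domain W)" "\<And>x. decomposable (F x) (W `` {x})"
    and "\<And>x x'. x \<in> Domain W \<Longrightarrow> x' \<in> Domain W \<Longrightarrow> E x x' \<Longrightarrow> clique (F x) (W `` {x})"
  shows "decomposable (lex_adj E F) W"
  using assms
proof (induction W rule: finite_psubset_induct)
  case (psubset W)
  note base = psubset.prems(1) and fibres = psubset.prems(2) and cliques = psubset.prems(3)
  have IH: "decomposable (lex_adj E F) U"
    if "U \<subset> W" "decomposable E (Domain U)" "\<And>x. decomposable (F x) (U `` {x})" for U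
  proof (rule psubset.IH[OF that])
    fix x x' assume "x \<in> Domain U" "x' \<in> Domain U" "E x x'"
    then have "clique (F x) (W `` {x})" using cliques that(1) by blast
    then show "clique (F x) (U `` {x})" using that(1) by (auto simp: clique_def)
  qed
  show ?case
  \<comment> \<open>By inversion of the inductive definition, this fails only if all fibres are edgeless.\<close>
  proof (cases "\<exists>x y. sheds (F x) (W `` {x}) y \<and> decomposable (F x) (W `` {x} - {y}) \<and>
      decomposable (F x) (W `` {x} - closed_nbrs (F x) y)")
    case True
    then obtain x y where y: "sheds (F x) (W `` {x}) y"
      and del: "decomposable (F x) (W `` {x} - {y})"
      and link: "decomposable (F x) (W `` {x} - closed_nbrs (F x) y)" by blast
    let ?A = "W `` {x}" and ?W1 = "W - {(x, y)}" and ?W2 = "W - closed_nbrs (lex_adj E F) (x, y)"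
    have xy: "(x, y) \<in> W" using sheds_mem[OF y] by simp
    have sub: "?W1 \<subset> W" "?W2 \<subset> W" using xy by (auto simp: closed_nbrs_def)
    have "sheds (lex_adj E F) W (x, y)"
    proof (rule shedsI[OF xy])
      fix S assume S: "S \<subseteq> ?W2" "edgeless (lex_adj E F) S"
      have "S `` {x} \<subseteq> ?A - closed_nbrs (F x) y" "edgeless (F x) (S `` {x})"
        using S by (auto simp: closed_nbrs_def edgeless_lex_adj)
      from shedsE[OF y this] obtain z
        where z: "z \<in> ?A" "F x y z" "\<And>s. s \<in> S `` {x} \<Longrightarrow> \<not> F x z s" by metis
      then show "\<exists>q\<in>W. lex_adj E F (x, y) q \<and> (\<forall>s\<in>S. \<not> lex_adj E F q s)"
        using S by (intro bexI[of _ "(x, z)"]) (auto simp: closed_nbrs_def)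
    qed
    moreover have "decomposable (lex_adj E F) ?W1"
    proof (rule IH[OF sub(1)])
      obtain z where "z \<in> ?A" "F x y z" using sheds_has_neighbour[OF y] by blast
      then have "Domain ?W1 = Domain W" using fibre_irrefl[of x y] by auto
      then show "decomposable E (Domain ?W1)" using base by simp
      show "decomposable (F z) (?W1 `` {z})" for z
        using del fibres by (auto simp: fibre_remove)
    qed
    moreover have "decomposable (lex_adj E F) ?W2"
    proof (rule IH[OF sub(2)])
      show "decomposable (F z) (?W2 `` {z})" for z
        using link fibres decomposable_empty by (auto simp: fibre_link)
      show "decomposable E (Domain ?W2)"
      proof (cases "?A \<subseteq> closed_nbrs (F x) y")
        case True
        \<comment> \<open>The fibre over \<open>x\<close> disappears, and the base becomes the link of \<open>x\<close>.\<close>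
        then have "Domain ?W2 = Domain W - closed_nbrs E x"
          unfolding set_eq_iff Domain_link by (auto simp: closed_nbrs_def)
        then show ?thesis using decomposable_link[OF base] xy by auto
      next
        case False
        \<comment> \<open>The fibre is no clique, so \<open>x\<close> is isolated and no fibre disappears.\<close>
        then obtain a where a: "(x, a) \<in> W" "a \<noteq> y" "\<not> F x y a" by (auto simp: closed_nbrs_def)
        then have "\<not> clique (F x) ?A" using xy unfolding clique_def by (metis Image_singleton_iff)
        then have "\<not> E x z" if "z \<in> Domain W" for z using cliques[of x z] that xy by blast
        then have "Domain ?W2 = Domain W"
          unfolding set_eq_iff Domain_link using False xy by auto
        then show ?thesis using base by simp
      qed
    qed
    ultimately show ?thesis by (rule decomposable.sheds)
  next
    case False
    have ind: "edgeless (F x) (W `` {x})" for x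
      using fibres[of x] False by (cases rule: decomposable.cases) blast+
    from base show ?thesis
    proof (cases rule: decomposable.cases)
      case edgeless
      then have "edgeless (lex_adj E F) W" using ind by (simp add: edgeless_lex_adj)
      then show ?thesis by (rule decomposable.edgeless)
    next
      case (sheds x)
      obtain x' where x': "x' \<in> Domain W" "E x x'" using sheds_has_neighbour[OF sheds(1)] by blast
      obtain y where xy: "(x, y) \<in> W" using sheds_mem[OF sheds(1)] by blast
      have "clique (F x) (W `` {x})" using cliques[of x x'] x' xy by blast
      then have single: "(x, z) \<in> W \<longleftrightarrow> z = y" for z
        using ind[of x] xy by (auto simp: clique_def edgeless_def)
      let ?W1 = "W - {(x, y)}" and ?W2 = "W - closed_nbrs (lex_adj E F) (x, y)"
      have sub: "?W1 \<subset> W" "?W2 \<subset> W" using xy by (auto simp: closed_nbrs_def)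
      have "sheds (lex_adj E F) W (x, y)"
      proof (rule shedsI[OF xy])
        fix S assume S: "S \<subseteq> ?W2" "edgeless (lex_adj E F) S"
        have "Domain S \<subseteq> Domain W - closed_nbrs E x" "edgeless E (Domain S)"
          using S single by (fastforce simp: closed_nbrs_def edgeless_def)+
        from shedsE[OF sheds(1) this] obtain u
          where u: "u \<in> Domain W" "E x u" "\<And>s. s \<in> Domain S \<Longrightarrow> \<not> E u s" by metis
        then obtain w where w: "(u, w) \<in> W" by blast
        have "u \<notin> Domain S" using S u by (auto simp: closed_nbrs_def)
        then show "\<exists>q\<in>W. lex_adj E F (x, y) q \<and> (\<forall>s\<in>S. \<not> lex_adj E F q s)"
          using u(2) u(3)[OF DomainI] w by (intro bexI[of _ "(u, w)"]) auto
      qed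
      moreover have "decomposable (lex_adj E F) ?W1"
      proof (rule IH[OF sub(1)])
        have "Domain ?W1 = Domain W - {x}" using single by auto
        then show "decomposable E (Domain ?W1)" using sheds by simp
        show "decomposable (F z) (?W1 `` {z})" for z
          by (rule decomposable.edgeless, rule edgeless_subset[OF ind]) blast
      qed
      moreover have "decomposable (lex_adj E F) ?W2"
      proof (rule IH[OF sub(2)])
        have "Domain ?W2 = Domain W - closed_nbrs E x"
          unfolding set_eq_iff Domain_link using single by (auto simp: closed_nbrs_def)
        then show "decomposable E (Domain ?W2)" using sheds by simp
        show "decomposable (F z) (?W2 `` {z})" for z
          by (rule decomposable.edgeless, rule edgeless_subset[OF ind]) blast
      qed
      ultimately show ?thesis by (rule decomposable.sheds)
    qed
  qed
qed

end

section \<open>Transfer to graphs\<close>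

text \<open>
  The relation \<open>E\<close> is constrained on the vertices of \<open>G\<close> only. Hence it keeps representing the
  graph after vertices are deleted, although adjacency in the smaller graph is a smaller relation.
\<close>

definition represents :: "('a \<Rightarrow> 'a \<Rightarrow> bool) \<Rightarrow> ('a, 'b) pre_digraph \<Rightarrow> bool" where
  "represents E G \<longleftrightarrow> graph G \<and> (\<forall>u\<in>verts G. \<forall>v\<in>verts G. E u v \<longleftrightarrow> u \<rightarrow>\<^bsub>G\<^esub> v)"

lemma dominates_in_verts:
  assumes "graph G" "u \<rightarrow>\<^bsub>G\<^esub> v"
  shows "u \<in> verts G" "v \<in> verts G"
proof -
  interpret graph G by (fact assms)
  show "u \<in> verts G" "v \<in> verts G" using assms(2) by (auto dest: adj_in_verts)
qed

lemma adjacency_dominates: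
  assumes "graph G"
  shows "adjacency (\<lambda>u v. u \<rightarrow>\<^bsub>G\<^esub> v)"
proof -
  interpret graph G by (fact assms)
  show ?thesis
    using sym_arcs by unfold_locales (auto simp: symmetric_def elim: symE dest: adj_not_same)
qed

lemma finite_verts_graph: "graph G \<Longrightarrow> finite (verts G)"
  by (meson digraph.axioms(1) fin_digraph.finite_verts graph.axioms(1))

lemma verts_delete_verts [simp]: "verts (delete_verts G S) = verts G - S"
  by (simp add: delete_verts_def)

lemma dominates_delete_verts:
  "u \<rightarrow>\<^bsub>delete_verts G S\<^esub> v \<longleftrightarrow> u \<rightarrow>\<^bsub>G\<^esub> v \<and> u \<in> verts G - S \<and> v \<in> verts G - S"
  by (auto simp: delete_verts_def arcs_ends_def arc_to_ends_def induce_subgraph_def)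

lemma represents_delete_verts:
  "represents E G \<Longrightarrow> represents E (delete_verts G S)"
  by (auto simp: represents_def dominates_delete_verts intro: graph_delete_verts)

lemma independent_set_iff_edgeless:
  "represents E G \<Longrightarrow> independent_set G S \<longleftrightarrow> S \<subseteq> verts G \<and> edgeless E S"
  unfolding independent_set_def edgeless_def represents_def by blast

lemma totally_disconnected_iff_edgeless:
  assumes "represents E G"
  shows "totally_disconnected G \<longleftrightarrow> edgeless E (verts G)"
proof -
  have G: "graph G" using assms by (simp add: represents_def)
  have "totally_disconnected G \<longleftrightarrow> (\<forall>u v. \<not> u \<rightarrow>\<^bsub>G\<^esub> v)"
    unfolding totally_disconnected_def arcs_ends_def
    by (metis all_not_in_conv image_eqI image_is_empty surj_pair)
  then show ?thesis
    using assms dominates_in_verts[OF G] unfolding edgeless_def represents_def by blast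
qed

lemma delete_closed_neighborhood:
  "represents E G \<Longrightarrow> x \<in> verts G \<Longrightarrow>
    verts G - closed_neighborhood G x = verts G - closed_nbrs E x"
  by (auto simp: represents_def closed_neighborhood_def neighborhood_def closed_nbrs_def)

text \<open>
  If \<open>S\<close> avoids the closed neighbourhood of a shedding vertex \<open>x\<close>, enlarge it to a maximal
  independent set \<open>M\<close> with this property. Since \<open>M\<close> is not maximal in \<open>G - x\<close>, it can be extended there,
  and by the choice of \<open>M\<close> only by neighbours of \<open>x\<close>. Conversely, an independent set that a
  neighbour of \<open>x\<close> extends is not maximal in \<open>G - x\<close>.
\<close>

lemma shedding_vertex_iff_sheds:
  assumes "represents E G"
  shows "shedding_vertex G x \<longleftrightarrow> sheds E (verts G) x"
proof (cases "x \<in> verts G")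
  case False
  then show ?thesis by (simp add: shedding_vertex_def sheds_def)
next
  case x: True
  let ?V = "verts G" and ?N = "closed_nbrs E x"
  have G: "graph G" and E: "\<And>u v. u \<in> ?V \<Longrightarrow> v \<in> ?V \<Longrightarrow> E u v \<longleftrightarrow> u \<rightarrow>\<^bsub>G\<^esub> v"
    using assms by (auto simp: represents_def)
  interpret A: adjacency "\<lambda>u v. u \<rightarrow>\<^bsub>G\<^esub> v" by (rule adjacency_dominates[OF G])
  have sym: "E u v \<Longrightarrow> E v u" and irrefl: "\<not> E u u" if "u \<in> ?V" "v \<in> ?V" for u v
    using E that A.sym A.irrefl by auto
  have link: "independent_set (delete_verts G (closed_neighborhood G x)) S \<longleftrightarrow>
      S \<subseteq> ?V - ?N \<and> edgeless E S" for S
    using independent_set_iff_edgeless[OF represents_delete_verts[OF assms]]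
      delete_closed_neighborhood[OF assms x] by simp
  have del: "independent_set (delete_verts G {x}) S \<longleftrightarrow> S \<subseteq> ?V - {x} \<and> edgeless E S" for S
    using independent_set_iff_edgeless[OF represents_delete_verts[OF assms]] by simp
  show ?thesis
  proof
    assume shed: "shedding_vertex G x"
    show "sheds E ?V x"
    proof (rule shedsI[OF x])
      fix S assume S: "S \<subseteq> ?V - ?N" "edgeless E S"
      define C where "C = {T. S \<subseteq> T \<and> T \<subseteq> ?V - ?N \<and> edgeless E T}"
      have "C \<subseteq> Pow ?V" by (auto simp: C_def)
      then have "finite C" using finite_verts_graph[OF G] by (simp add: finite_subset)
      moreover have "S \<in> C" using S by (simp add: C_def)
      ultimately obtain M where "M \<in> C" and max: "\<forall>T\<in>C. M \<subseteq> T \<longrightarrow> M = T"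
        by (meson finite_has_maximal2)
      then have M: "S \<subseteq> M" "M \<subseteq> ?V - ?N" "edgeless E M" by (simp_all add: C_def)
      have "\<not> maximal_independent_set (delete_verts G {x}) M"
        using shed M link by (auto simp: shedding_vertex_def)
      moreover have "M \<subseteq> ?V - {x}" using M by (auto simp: closed_nbrs_def)
      ultimately obtain T where T: "T \<subseteq> ?V - {x}" "edgeless E T" "M \<subseteq> T" "T \<noteq> M"
        using M by (auto simp: maximal_independent_set_def del)
      then obtain y where y: "y \<in> T" "y \<notin> M" by blast
      have *: "edgeless E (insert y M)" using T y by (auto intro: edgeless_subset)
      have "y \<notin> ?V - ?N"
      proof
        assume "y \<in> ?V - ?N"
        then have "insert y M \<in> C" using * M by (auto simp: C_def)
        then show False using max y by blast
      qed
      then have "E x y" using T y by (auto simp: closed_nbrs_def)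
      moreover have "\<forall>s\<in>S. \<not> E y s" using T y M by (auto simp: edgeless_def)
      ultimately show "\<exists>y\<in>?V. E x y \<and> (\<forall>s\<in>S. \<not> E y s)" using T y by blast
    qed
  next
    assume shed: "sheds E ?V x"
    have False if S: "S \<subseteq> ?V - ?N" "edgeless E S"
      and max: "maximal_independent_set (delete_verts G {x}) S" for S
    proof -
      obtain y where y: "y \<in> ?V" "E x y" "\<And>s. s \<in> S \<Longrightarrow> \<not> E y s"
        using shedsE[OF shed S] by metis
      have "\<not> E s y" if "s \<in> S" for s using that y S sym by blast
      then have "edgeless E (insert y S)" using y S irrefl by (auto simp: edgeless_def)
      moreover have "y \<noteq> x" using y x irrefl by auto
      ultimately have "independent_set (delete_verts G {x}) (insert y S)"
        using S y by (auto simp: del closed_nbrs_def)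
      then have "y \<in> S" using max unfolding maximal_independent_set_def by blast
      then show False using S y by (auto simp: closed_nbrs_def)
    qed
    then show "shedding_vertex G x" using x link by (auto simp: shedding_vertex_def)
  qed
qed

lemma vertex_decomposable_iff_decomposable:
  assumes "represents E G"
  shows "vertex_decomposable G \<longleftrightarrow> decomposable E (verts G)"
proof
  assume "vertex_decomposable G"
  then show "decomposable E (verts G)"
    using assms
  proof (induction rule: vertex_decomposable.induct)
    case (totally_disconnected G)
    then show ?case by (auto simp: totally_disconnected_iff_edgeless intro: decomposable.edgeless)
  next
    case (shedding G x)
    have x: "x \<in> verts G" using shedding.hyps(1) by (simp add: shedding_vertex_def)
    have "sheds E (verts G) x"
      using shedding.hyps(1) shedding_vertex_iff_sheds[OF shedding.prems] by simp
    then show ?case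
      using shedding.IH[OF represents_delete_verts[OF shedding.prems]]
        delete_closed_neighborhood[OF shedding.prems x]
      by (auto intro: decomposable.sheds)
  qed
next
  have "represents E G \<Longrightarrow> verts G = V \<Longrightarrow> vertex_decomposable G"
    if "decomposable E V" for V and G :: "('a, 'b) pre_digraph"
    using that
  proof (induction V arbitrary: G rule: decomposable.induct)
    case (edgeless V)
    then show ?case
      by (auto simp: totally_disconnected_iff_edgeless intro: vertex_decomposable.totally_disconnected)
  next
    case (sheds V x)
    note rep = sheds.prems(1) and V = sheds.prems(2)
    have x: "x \<in> verts G" using sheds_mem[OF sheds.hyps(1)] V by simp
    show ?case
    proof (rule vertex_decomposable.shedding)
      show "shedding_vertex G x" using shedding_vertex_iff_sheds[OF rep] sheds.hyps(1) V by simp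
      show "vertex_decomposable (delete_verts G {x})"
        using represents_delete_verts[OF rep] V by (intro sheds.IH(1)) auto
      show "vertex_decomposable (delete_verts G (closed_neighborhood G x))"
        using represents_delete_verts[OF rep] delete_closed_neighborhood[OF rep x] V
        by (intro sheds.IH(2)) auto
    qed
  qed
  then show "decomposable E (verts G) \<Longrightarrow> vertex_decomposable G" using assms by blast
qed

lemma complete_graph_iff_clique:
  assumes "represents E G"
  shows "complete_graph G \<longleftrightarrow> clique E (verts G)"
proof -
  have G: "graph G" using assms by (simp add: represents_def)
  interpret A: adjacency "\<lambda>u v. u \<rightarrow>\<^bsub>G\<^esub> v" by (rule adjacency_dominates[OF G])
  have "complete_graph G \<longleftrightarrow> (\<forall>u v. u \<rightarrow>\<^bsub>G\<^esub> v \<longleftrightarrow> u \<in> verts G \<and> v \<in> verts G \<and> u \<noteq> v)"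
    using G by (auto simp: complete_graph_def complete_digraph_def set_eq_iff)
  also have "\<dots> \<longleftrightarrow> (\<forall>u\<in>verts G. \<forall>v\<in>verts G. u \<noteq> v \<longrightarrow> u \<rightarrow>\<^bsub>G\<^esub> v)"
    using dominates_in_verts[OF G] A.irrefl by metis
  also have "\<dots> \<longleftrightarrow> clique E (verts G)"
    using assms by (auto simp: clique_def represents_def)
  finally show ?thesis .
qed

lemma represents_lexicographic_product:
  assumes "graph G" "\<And>x. x \<in> verts G \<Longrightarrow> graph (H x)"
    and "represents E G" "\<And>x. x \<in> verts G \<Longrightarrow> represents (F x) (H x)"
  shows "represents (lex_adj E F) (lexicographic_product G H)"
  unfolding represents_def
proof
  show "graph (lexicographic_product G H)" by (rule graph_lexicographic_product[OF assms(1,2)])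
  show "\<forall>p\<in>verts (lexicographic_product G H). \<forall>q\<in>verts (lexicographic_product G H).
      lex_adj E F p q \<longleftrightarrow> p \<rightarrow>\<^bsub>lexicographic_product G H\<^esub> q"
    using assms(3,4) by (fastforce simp: lexicographic_product_def represents_def)
qed

section \<open>Vertex decomposability of lexicographic products\<close>

theorem theorem2p19:
  fixes G :: "('a, 'b) pre_digraph"
    and H :: "'a \<Rightarrow> ('c, 'd) pre_digraph"
  assumes "graph G" and "verts G \<noteq> {}"
    and "\<And>x. x \<in> verts G \<Longrightarrow> graph (H x)"
    and "\<And>x. x \<in> verts G \<Longrightarrow> verts (H x) \<noteq> {}"
  shows "((\<forall>x\<in>verts G. complete_graph (H x)) \<longrightarrow>
            (vertex_decomposable (lexicographic_product G H) \<longleftrightarrow> vertex_decomposable G)) \<and>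
         (totally_disconnected G \<longrightarrow>
            ((\<forall>x\<in>verts G. vertex_decomposable (H x)) \<longleftrightarrow>
             vertex_decomposable (lexicographic_product G H))) \<and>
         (\<not> totally_disconnected G \<and> vertex_decomposable (lexicographic_product G H) \<longrightarrow>
            (\<exists>x\<in>verts G. complete_graph (H x))) \<and>
         (vertex_decomposable (lexicographic_product G H) \<longrightarrow>
            vertex_decomposable G \<and> (\<forall>x\<in>verts G. vertex_decomposable (H x)))"
proof -
  define E where "E = (\<lambda>u v. u \<rightarrow>\<^bsub>G\<^esub> v)"
  \<comment> \<open>The guard makes \<open>F x\<close> symmetric and irreflexive also where \<open>H x\<close> is not assumed to be a graph.\<close>
  define F where "F = (\<lambda>x y z. x \<in> verts G \<and> y \<rightarrow>\<^bsub>H x\<^esub> z)"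
  define W where "W = (SIGMA x:verts G. verts (H x))"
  have repG: "represents E G" using assms(1) by (simp add: represents_def E_def)
  have repH: "represents (F x) (H x)" if "x \<in> verts G" for x
    using assms(3) that by (simp add: represents_def F_def)
  have repP: "represents (lex_adj E F) (lexicographic_product G H)"
    using represents_lexicographic_product assms(1,3) repG repH by blast
  have vP: "verts (lexicographic_product G H) = W"
    by (simp add: lexicographic_product_def W_def)
  have dom: "Domain W = verts G" using assms(4) by (auto simp: W_def)
  have fib: "W `` {x} = (if x \<in> verts G then verts (H x) else {})" for x
    by (auto simp: W_def)
  have finH: "finite (verts (H x))" if "x \<in> verts G" for x
    by (rule finite_verts_graph[OF assms(3)[OF that]])
  have finW: "finite W"
    unfolding W_def by (rule finite_SigmaI[OF finite_verts_graph[OF assms(1)] finH])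
  have adjF: "adjacency (F x)" for x
  proof (cases "x \<in> verts G")
    case True
    then show ?thesis using adjacency_dominates[OF assms(3)[OF True]] by (simp add: F_def)
  qed (simp add: F_def adjacency_def)
  interpret lex_product E F
    unfolding lex_product_def lex_product_axioms_def
    using adjacency_dominates[OF assms(1)] adjF by (simp add: E_def)
  note tdG = totally_disconnected_iff_edgeless[OF repG]
  note vdG = vertex_decomposable_iff_decomposable[OF repG]
  note vdP = vertex_decomposable_iff_decomposable[OF repP, unfolded vP]
  note vdH = vertex_decomposable_iff_decomposable[OF repH]
  note cgH = complete_graph_iff_clique[OF repH]
  have all_vd: "(\<forall>x\<in>verts G. vertex_decomposable (H x)) \<longleftrightarrow>
      (\<forall>x\<in>verts G. decomposable (F x) (verts (H x)))"
    and all_complete: "(\<forall>x\<in>verts G. complete_graph (H x)) \<longleftrightarrow>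
      (\<forall>x\<in>verts G. clique (F x) (verts (H x)))"
    and ex_complete: "(\<exists>x\<in>verts G. complete_graph (H x)) \<longleftrightarrow>
      (\<exists>x\<in>verts G. clique (F x) (verts (H x)))"
    using vdH cgH by (simp_all cong: ball_cong bex_cong)
  have fibD: "decomposable (F x) (W `` {x})" 
    if "\<forall>x\<in>verts G. decomposable (F x) (verts (H x))" for x
    using that by (simp add: fib decomposable_empty)
  have necessary: "decomposable E (verts G) \<and> (\<forall>x\<in>verts G. decomposable (F x) (verts (H x))) \<and>
      (\<not> edgeless E (verts G) \<longrightarrow> (\<exists>x\<in>verts G. clique (F x) (verts (H x))))"
    if "decomposable (lex_adj E F) W"
    using decomposable_lex_adjD[OF that] unfolding dom fib by (auto split: if_splits)
  have from_cliques: "decomposable (lex_adj E F) W"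
    if cliques: "\<forall>x\<in>verts G. clique (F x) (verts (H x))" and "decomposable E (verts G)"
  proof (rule decomposable_lex_adjI[OF finW])
    show "decomposable E (Domain W)" using that dom by simp
    show "decomposable (F x) (W `` {x})" for x
      by (rule fibD) (use adjacency.decomposable_clique[OF adjF finH] cliques in simp)
    show "clique (F x) (W `` {x})" if "x \<in> Domain W" for x
      using cliques that dom fib by simp
  qed
  have from_edgeless_base: "decomposable (lex_adj E F) W"
    if "edgeless E (verts G)" "\<forall>x\<in>verts G. decomposable (F x) (verts (H x))"
  proof (rule decomposable_lex_adjI[OF finW])
    show "decomposable E (Domain W)" using that dom by (simp add: decomposable.edgeless)
    show "decomposable (F x) (W `` {x})" for x using that(2) by (rule fibD)
    show "clique (F x) (W `` {x})" if "x \<in> Domain W" "x' \<in> Domain W" "E x x'" for x x'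
      using \<open>edgeless E (verts G)\<close> that dom by (simp add: edgeless_def)
  qed
  show ?thesis
    unfolding tdG vdG vdP all_vd all_complete ex_complete
    using necessary from_cliques from_edgeless_base by argo
qed

end
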